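(* Let $B$ be the unit ball in $\mathbb{R}^d$, where $d\in\{2,3\}$. Then $$\lim_{t\to 0+}\frac{1}{t}\left(|B|-\mathbb{H}_B(t)-\frac{|\mathbb{S}^{d-1}|}{\pi}\,t\ln\left(\frac1t\right)\right)=\begin{cases}6\ln(2)-2 & \text{if } d=2,\\ 4\ln(2) & \text{if } d=3.\end{cases}$$
   Context: $|x|$ denotes the Euclidean norm of $x\in\mathbb{R}^d$. $B=\{x\in\mathbb{R}^d:|x|<1\}$ is the unit ball centered at the origin (open or closed is immaterial), $|B|$ is its volume, and $|\mathbb{S}^{d-1}|$ is the surface area of its boundary $\mathbb{S}^{d-1}$. Constant: $\kappa_d=\Gamma\left(\frac{d+1}{2}\right)\pi^{-\frac{d+1}{2}}$. Poisson heat kernel: $p_t(x)=\dfrac{\kappa_d\,t}{(t^2+|x|^2)^{(d+1)/2}}$ for $x\in\mathbb{R}^d$, $t>0$. Heat content over the unit ball: $\mathbb{H}_B(t)=\int_B\int_B p_t(x-y)\,dy\,dx$. *)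

theory Defs
  imports "HOL-Analysis.Analysis"
begin

definition kappa :: "nat \<Rightarrow> real" where
  "kappa d = Gamma ((real d + 1) / 2) * pi powr (- ((real d + 1) / 2))"

definition poisson_kernel :: "real \<Rightarrow> real ^ 'n::finite \<Rightarrow> real" where
  "poisson_kernel t x =
     kappa CARD('n) * t / (t\<^sup>2 + (norm x)\<^sup>2) powr ((real CARD('n) + 1) / 2)"

definition heat_content :: "(real ^ 'n::finite) set \<Rightarrow> real \<Rightarrow> real" where
  "heat_content \<Omega> t = (LINT x:\<Omega>|lborel. (LINT y:\<Omega>|lborel. poisson_kernel t (x - y)))"

text \<open>
  Surface area, as the Minkowski content of codimension 1: the volume of the open
  \<open>\<epsilon>\<close>-neighbourhood of \<open>S\<close> (which extends to both sides of the surface) divided by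
  its thickness \<open>2 * \<epsilon>\<close>, in the limit. It is meant for compact smooth hypersurfaces, where
  the limit exists and equals the (CARD('n) - 1)-dimensional Hausdorff measure;
  otherwise \<^const>\<open>Lim\<close> may be unspecified. \<open>surface_area_unit_sphere\<close> below shows that
  it has the classical value on the unit sphere.
\<close>

definition surface_area :: "(real ^ 'n::finite) set \<Rightarrow> real" where
  "surface_area S =
     Lim (at_right 0) (\<lambda>\<epsilon>. measure lborel (\<Union>a\<in>S. ball a \<epsilon>) / (2 * \<epsilon>))"

lemma sphere_neighbourhood:
  assumes "0 < \<epsilon>" "\<epsilon> < 1"
  shows "(\<Union>a\<in>sphere (0 :: real ^ 'n::finite) 1. ball a \<epsilon>) = ball 0 (1 + \<epsilon>) - cball 0 (1 - \<epsilon>)"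
proof (intro equalityI subsetI)
  fix x :: "real ^ 'n"
  assume "x \<in> (\<Union>a\<in>sphere 0 1. ball a \<epsilon>)"
  then obtain a :: "real ^ 'n" where a: "norm a = 1" "norm (a - x) < \<epsilon>"
    by (auto simp: dist_norm)
  then show "x \<in> ball 0 (1 + \<epsilon>) - cball 0 (1 - \<epsilon>)"
    using norm_triangle_ineq3[of a x] by (auto simp: abs_if split: if_splits)
next
  fix x :: "real ^ 'n"
  assume x: "x \<in> ball 0 (1 + \<epsilon>) - cball 0 (1 - \<epsilon>)"
  define a where "a = x /\<^sub>R norm x"
  have "x \<noteq> 0" using x assms by auto
  then have a: "norm a = 1" by (simp add: a_def)
  have "norm (a - x) = norm ((1 - norm x) *\<^sub>R a)"
    using \<open>x \<noteq> 0\<close> by (simp add: a_def algebra_simps)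
  also have "\<dots> = \<bar>1 - norm x\<bar>" by (simp add: a)
  finally have "norm (a - x) < \<epsilon>" using x by auto
  with a show "x \<in> (\<Union>a\<in>sphere 0 1. ball a \<epsilon>)" by (auto simp: dist_norm)
qed

lemma surface_area_unit_sphere:
  "surface_area (sphere (0 :: real ^ 'n::finite) 1) = real CARD('n) * measure lborel (ball (0 :: real ^ 'n) 1)"
proof -
  let ?n = "CARD('n)"
  let ?V = "measure lborel (ball (0 :: real ^ 'n) 1)"
  let ?f = "\<lambda>\<epsilon>. measure lborel (\<Union>a\<in>sphere (0 :: real ^ 'n) 1. ball a \<epsilon>) / (2 * \<epsilon>)"
  let ?g = "\<lambda>\<epsilon>. (?V * ((1 + \<epsilon>) ^ ?n - (1 - \<epsilon>) ^ ?n) / 2) / \<epsilon>"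
  have "?f \<epsilon> = ?g \<epsilon>" if "0 < \<epsilon>" "\<epsilon> < 1" for \<epsilon> :: real
  proof -
    have "measure lborel (ball (0 :: real ^ 'n) (1 + \<epsilon>) - cball 0 (1 - \<epsilon>))
        = measure lborel (ball (0 :: real ^ 'n) (1 + \<epsilon>)) - measure lborel (cball (0 :: real ^ 'n) (1 - \<epsilon>))"
      using that emeasure_lborel_ball_finite[of "0 :: real ^ 'n" "1 + \<epsilon>"]
      by (intro measure_Diff) (auto simp: subset_eq)
    also have "\<dots> = ?V * ((1 + \<epsilon>) ^ ?n - (1 - \<epsilon>) ^ ?n)"
      using that by (simp add: content_ball content_cball algebra_simps)
    finally show ?thesis using that by (simp add: sphere_neighbourhood)
  qed
  then have ev: "eventually (\<lambda>\<epsilon>. ?g \<epsilon> = ?f \<epsilon>) (at_right 0)"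
    by (intro eventually_at_rightI[of 0 1]) auto
  have "((\<lambda>\<epsilon>. ?V * ((1 + \<epsilon>) ^ ?n - (1 - \<epsilon>) ^ ?n) / 2) has_real_derivative real ?n * ?V) (at 0)"
    by (auto intro!: derivative_eq_intros)
  then have "(?g \<longlongrightarrow> real ?n * ?V) (at 0)"
    by (simp add: DERIV_def)
  then have "(?g \<longlongrightarrow> real ?n * ?V) (at_right 0)"
    by (rule tendsto_mono[OF at_le, rotated]) simp
  then have "(?f \<longlongrightarrow> real ?n * ?V) (at_right 0)"
    using ev by (rule Lim_transform_eventually)
  then show ?thesis
    unfolding surface_area_def by (intro tendsto_Lim) simp_all
qed

end

theory Submission
  imports Defs "HOL-Real_Asymp.Real_Asymp"
begin

text \<open>
  Since the kernel has total mass \<open>1\<close>, Fubini turns the heat loss \<open>|B| - H\<^sub>B(t)\<close> into the integral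
  over all displacements \<open>z\<close> of \<open>p\<^sub>t(z)\<close> times \<open>|B| - |B \<inter> (B + z)|\<close>. The
  lens \<open>B \<inter> (B + z)\<close> consists of two congruent caps, and two caps congruent to them remain when the slab
  \<open>|x \<bullet> z| \<le> |z|\<^sup>2 / 2\<close> is cut out of \<open>B\<close>. Hence \<open>|B| - |B \<inter> (B + z)|\<close> is the
  volume \<open>S(r)\<close> of a central slab of \<open>B\<close> of width \<open>r = |z|\<close> (\<open>emeasure_ball_overlap\<close>). Its
  derivative is the volume of a section of the ball by a hyperplane,
  \<open>S'(r) = \<omega> sqrt (1 - r\<^sup>2 / 4) ^ (d - 1)\<close> for \<open>0 < r < 2\<close>, where \<open>\<omega>\<close> is the volume of the unit ball in
  dimension \<open>d - 1\<close>.

  In polar coordinates the heat loss is therefore \<open>K t\<close> times the integral over \<open>r > 0\<close> of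
  \<open>q\<^sub>t(r) S(r)\<close>, where \<open>q\<^sub>t(r) = r ^ (d - 1) / (t\<^sup>2 + r\<^sup>2) powr ((d + 1) / 2)\<close>
  (\<open>heat_loss_radial\<close>). As \<open>t\<close> tends to \<open>0\<close>, \<open>q\<^sub>t(r)\<close> increases to \<open>1 / r\<^sup>2\<close>, while
  \<open>S(r)\<close> is close to \<open>\<omega> r\<close> near \<open>0\<close>; this is the source of the logarithm. The proof separates
  the two effects. Replacing \<open>S(r)\<close> by \<open>\<omega> r\<close> on \<open>[0, 2]\<close> gives an elementary integral,
  which carries the whole singularity: it is \<open>\<omega> (ln (1 / t) + c + o(1))\<close>. The remainder is dominated by an
  integrable function independent of \<open>t\<close>, so its limit is the integral of
  \<open>(S(r) - \<omega> r 1\<^bsub>r < 2\<^esub>) / r\<^sup>2\<close>. An integration by parts evaluates this as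
  \<open>\<omega> (1 + J)\<close>, where \<open>J\<close> is the integral of \<open>(sqrt (1 - s\<^sup>2) ^ (d - 1) - 1) / s\<close> over
  \<open>[0, 1]\<close>.

  The limit is thus \<open>K \<omega> (1 + J + c)\<close> (\<open>heat_loss_expansion\<close>). In dimension \<open>2\<close> one has
  \<open>K \<omega> = 2\<close>, \<open>J = ln 2 - 1\<close>, \<open>c = 2 ln 2 - 1\<close>; in dimension \<open>3\<close> one has
  \<open>K \<omega> = 4\<close>, \<open>J = - 1 / 2\<close>, \<open>c = ln 2 - 1 / 2\<close>. In both cases \<open>K \<omega>\<close> is the
  surface area of the sphere divided by \<open>\<pi>\<close>, so it is the coefficient of the logarithm.
\<close>

section \<open>Reflections and orthogonal maps preserve Lebesgue measure\<close>

lemma nn_integral_lborel_reflect: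
  fixes c :: "'a::euclidean_space"
  assumes [measurable]: "f \<in> borel_measurable borel"
  shows "(\<integral>\<^sup>+x. f (c - x) \<partial>lborel) = (\<integral>\<^sup>+x. f x \<partial>lborel)"
proof -
  have "(\<integral>\<^sup>+x. f x \<partial>lborel) = (\<integral>\<^sup>+x. f x \<partial>distr lborel borel (\<lambda>x. c + (-1) *\<^sub>R x))"
    using lborel_affine[of "-1" c] by (simp add: density_1)
  also have "\<dots> = (\<integral>\<^sup>+x. f (c - x) \<partial>lborel)"
    by (subst nn_integral_distr) auto
  finally show ?thesis ..
qed

lemma emeasure_lborel_reflect:
  fixes c :: "'a::euclidean_space"
  assumes [measurable]: "A \<in> sets borel"
  shows "emeasure lborel {x. c - x \<in> A} = emeasure lborel A"
proof -
  have "emeasure lborel {x. c - x \<in> A} = (\<integral>\<^sup>+x. indicator {x. c - x \<in> A} x \<partial>lborel)"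
    by (rule nn_integral_indicator[symmetric]) simp
  also have "\<dots> = (\<integral>\<^sup>+x. indicator A (c - x) \<partial>lborel)"
    by (simp add: indicator_def)
  also have "\<dots> = (\<integral>\<^sup>+x. indicator A x \<partial>lborel)"
    by (rule nn_integral_lborel_reflect) measurable
  finally show ?thesis by simp
qed

text \<open>
  This is the uniqueness argument for invariant measures. Let \<open>V\<close> be the unit ball. Integrating
  \<open>1\<^sub>A (f x) 1\<^sub>V (y - f x)\<close> over \<open>y\<close> first gives the product of the measures of \<open>f -` A\<close> and
  of \<open>V\<close>. A reflection in \<open>x\<close> exchanges the roles of \<open>f x\<close> and \<open>y - f x\<close>; as \<open>f\<close> preserves
  \<open>V\<close>, integrating over \<open>y\<close> first then gives the product of the measures of \<open>A\<close> and of \<open>V\<close>.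
\<close>

lemma emeasure_lborel_orthogonal:
  fixes f :: "'a::euclidean_space \<Rightarrow> 'a"
  assumes f: "orthogonal_transformation f" and [measurable]: "A \<in> sets borel"
  shows "emeasure lborel {x. f x \<in> A} = emeasure lborel A"
proof -
  let ?B = "ball (0 :: 'a) 1"
  have [measurable]: "?B \<in> sets borel" by simp
  have lin: "linear f" and norm: "norm (f x) = norm x" for x
    using f by (auto simp: orthogonal_transformation)
  have [measurable]: "f \<in> borel_measurable borel"
    using lin by (intro borel_measurable_continuous_onI linear_continuous_on linear_conv_bounded_linear[THEN iffD1])
  have swap: "(\<integral>\<^sup>+x. indicator A (f x) * indicator ?B (y - f x) \<partial>lborel)
      = (\<integral>\<^sup>+x. indicator A (y - f x) * indicator ?B x \<partial>lborel)" for y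
  proof -
    obtain y' where y': "y = f y'"
      using orthogonal_transformation_surj[OF f] by (auto simp: surj_def)
    have "(\<integral>\<^sup>+x. indicator A (f x) * indicator ?B (y - f x) \<partial>lborel)
        = (\<integral>\<^sup>+x. indicator A (f (y' - x)) * indicator ?B (y - f (y' - x)) \<partial>lborel)"
      by (rule nn_integral_lborel_reflect[symmetric]) measurable
    also have "\<dots> = (\<integral>\<^sup>+x. indicator A (y - f x) * indicator ?B x \<partial>lborel)"
      using lin by (intro nn_integral_cong) (simp add: y' linear_diff indicator_def norm)
    finally show ?thesis .
  qed
  have "emeasure lborel {x. f x \<in> A} * emeasure lborel ?B
      = (\<integral>\<^sup>+x. indicator A (f x) * emeasure lborel ?B \<partial>lborel)"
  proof (subst nn_integral_multc)
    show "emeasure lborel {x. f x \<in> A} * emeasure lborel ?B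
      = (\<integral>\<^sup>+x. indicator A (f x) \<partial>lborel) * emeasure lborel ?B"
    proof -
      have "(\<integral>\<^sup>+x. indicator A (f x) \<partial>lborel) = (\<integral>\<^sup>+x. indicator {x. f x \<in> A} x \<partial>lborel)"
        by (simp add: indicator_def)
      also have "\<dots> = emeasure lborel {x. f x \<in> A}"
        by (rule nn_integral_indicator) measurable
      finally show ?thesis by simp
    qed
  qed measurable
  also have "\<dots> = (\<integral>\<^sup>+x. indicator A (f x) * (\<integral>\<^sup>+y. indicator ?B (y - f x) \<partial>lborel) \<partial>lborel)"
  proof (intro nn_integral_cong arg_cong2[where f="(*)"] refl)
    fix x
    have "(\<integral>\<^sup>+y. indicator ?B (y - f x) \<partial>lborel) = (\<integral>\<^sup>+y. indicator ?B (f x - y) \<partial>lborel)"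
      by (simp add: indicator_def dist_norm norm_minus_commute)
    also have "\<dots> = (\<integral>\<^sup>+y. indicator ?B y \<partial>lborel)"
      by (rule nn_integral_lborel_reflect) measurable
    finally show "emeasure lborel ?B = (\<integral>\<^sup>+y. indicator ?B (y - f x) \<partial>lborel)" by simp
  qed
  also have "\<dots> = (\<integral>\<^sup>+x. \<integral>\<^sup>+y. indicator A (f x) * indicator ?B (y - f x) \<partial>lborel \<partial>lborel)"
    by (subst nn_integral_cmult) auto
  also have "\<dots> = (\<integral>\<^sup>+y. \<integral>\<^sup>+x. indicator A (f x) * indicator ?B (y - f x) \<partial>lborel \<partial>lborel)"
    by (rule lborel_pair.Fubini') measurable
  also have "\<dots> = (\<integral>\<^sup>+y. \<integral>\<^sup>+x. indicator A (y - f x) * indicator ?B x \<partial>lborel \<partial>lborel)"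
    by (simp only: swap)
  also have "\<dots> = (\<integral>\<^sup>+x. \<integral>\<^sup>+y. indicator A (y - f x) * indicator ?B x \<partial>lborel \<partial>lborel)"
    by (rule lborel_pair.Fubini') measurable
  also have "\<dots> = (\<integral>\<^sup>+x. emeasure lborel A * indicator ?B x \<partial>lborel)"
  proof (rule nn_integral_cong)
    fix x
    have "(\<integral>\<^sup>+y. indicator A (y - f x) \<partial>lborel) = (\<integral>\<^sup>+y. indicator A y \<partial>distr lborel borel ((+) (- f x)))"
      by (subst nn_integral_distr) auto
    then show "(\<integral>\<^sup>+y. indicator A (y - f x) * indicator ?B x \<partial>lborel) = emeasure lborel A * indicator ?B x"
      by (subst nn_integral_multc) (auto simp: lborel_distr_plus)
  qed
  also have "\<dots> = emeasure lborel A * emeasure lborel ?B"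
    by (subst nn_integral_cmult) auto
  finally have "emeasure lborel {x. f x \<in> A} * emeasure lborel ?B = emeasure lborel A * emeasure lborel ?B" .
  moreover have "unit_ball_vol (real DIM('a)) \<noteq> 0"
    by (metis less_irrefl of_nat_0_le_iff unit_ball_vol_pos)
  then have "emeasure lborel ?B \<noteq> 0" "emeasure lborel ?B \<noteq> top"
    by (auto simp: emeasure_ball)
  ultimately show ?thesis
    by (metis mult_divide_eq_ennreal)
qed

section \<open>Central slabs of the unit ball\<close>

text \<open>
  Up to the constant \<open>unit_ball_vol m\<close>, this is the \<open>m\<close>-dimensional volume of the section of the
  \<open>(m + 1)\<close>-dimensional unit ball by a hyperplane at distance \<open>|v|\<close> from the centre. The radicand is
  truncated because the square root of a negative real is defined as a negative real: with the
  truncation the function vanishes outside the ball when \<open>m > 0\<close>.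
\<close>

definition chord :: "nat \<Rightarrow> real \<Rightarrow> real" where
  "chord m v = sqrt (max 0 (1 - v\<^sup>2)) ^ m"

definition chord_integral :: "nat \<Rightarrow> real \<Rightarrow> real" where
  "chord_integral m u = (LBINT v=0..u. chord m v)"

text \<open>
  The volume of the part of the \<open>(m + 1)\<close>-dimensional unit ball within distance \<open>r / 2\<close> of a
  hyperplane through the centre. Negative \<open>r\<close> are admitted because the behaviour at \<open>0\<close> is
  read off from a two-sided derivative.
\<close>

definition slab_volume :: "nat \<Rightarrow> real \<Rightarrow> real" where
  "slab_volume m r = unit_ball_vol m * (chord_integral m (r / 2) - chord_integral m (- (r / 2)))"

lemma chord_nonneg: "0 \<le> chord m v"
  by (simp add: chord_def)

lemma continuous_chord: "continuous_on A (chord m)"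
  unfolding chord_def by (intro continuous_intros)

lemma borel_chord [measurable]: "chord m \<in> borel_measurable borel"
  unfolding chord_def by measurable

lemma chord_integral_deriv: "(chord_integral m has_real_derivative chord m u) (at u)"
proof -
  have "((\<lambda>u. LBINT v=0..u. chord m v) has_vector_derivative chord m u) (at u within {-(\<bar>u\<bar>+1)..\<bar>u\<bar>+1})"
    using interval_integral_FTC2[of "-(\<bar>u\<bar>+1)" 0 "\<bar>u\<bar>+1" "chord m" u] continuous_chord
    by (auto simp: zero_ereal_def)
  moreover have "at u within {-(\<bar>u\<bar>+1)..\<bar>u\<bar>+1} = at u"
    by (intro at_within_interior) (auto simp: interior_atLeastAtMost_real)
  ultimately show ?thesis
    by (simp add: chord_integral_def[abs_def] has_real_derivative_iff_has_vector_derivative)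
qed

lemma slab_volume_deriv:
  "(slab_volume m has_real_derivative unit_ball_vol m * chord m (r / 2)) (at r)"
proof -
  have "chord m (- (r/2)) = chord m (r/2)" by (simp add: chord_def)
  then show ?thesis
    unfolding slab_volume_def[abs_def]
    by (auto intro!: derivative_eq_intros DERIV_chain2[OF chord_integral_deriv])
qed

text \<open>
  Cavalieri's principle: the section at height \<open>y\<close> in the direction \<open>b\<close> is a ball of radius
  \<open>sqrt (1 - y\<^sup>2)\<close> in the remaining coordinates. The dimension has to be at least two, since
  \<open>chord 0\<close> is constantly \<open>1\<close> and so does not vanish outside the ball.
\<close>

lemma emeasure_slab_basis:
  fixes b :: "'a::euclidean_space"
  assumes b: "b \<in> Basis" and r: "0 \<le> r" and dim: "2 \<le> DIM('a)"
  shows "emeasure lborel {x \<in> cball 0 1. \<bar>x \<bullet> b\<bar> \<le> r / 2} = slab_volume (DIM('a) - 1) r"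
proof -
  define A where "A = Basis - {b}"
  have A: "finite A" "b \<notin> A" "Basis = insert b A" "card A = DIM('a) - 1"
    using b by (auto simp: A_def)
  let ?M = "\<lambda>A::'a set. Pi\<^sub>M A (\<lambda>_. lborel :: real measure)"
  let ?S = "{f \<in> space (?M (insert b A)). (\<Sum>i\<in>insert b A. (f i)\<^sup>2) \<le> 1 \<and> \<bar>f b\<bar> \<le> r / 2}"
  let ?D = "\<lambda>y. {f. sqrt (\<Sum>i\<in>A. (f i)\<^sup>2) \<le> sqrt (1 - y\<^sup>2)} \<inter> space (?M A)"
  interpret product_sigma_finite "\<lambda>_::'a. lborel :: real measure" by standard
  have bA: "b \<in> insert b A" by simp
  have comp: "(\<lambda>f. f b) \<in> borel_measurable (?M (insert b A))"
    using measurable_component_singleton[OF bA, of "\<lambda>_. lborel"] by simp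
  have sum: "(\<lambda>f. \<Sum>i\<in>insert b A. (f i)\<^sup>2) \<in> borel_measurable (?M (insert b A))"
    by (intro borel_measurable_sum borel_measurable_power)
       (use measurable_component_singleton[of _ "insert b A" "\<lambda>_. lborel"] in simp)
  have S: "?S \<in> sets (?M (insert b A))"
  proof -
    note [measurable] = comp sum
    show ?thesis by measurable
  qed
  have "emeasure lborel {x::'a \<in> cball 0 1. \<bar>x \<bullet> b\<bar> \<le> r / 2}
      = emeasure (distr (?M Basis) borel (\<lambda>f. \<Sum>b\<in>Basis. f b *\<^sub>R b)) {x::'a \<in> cball 0 1. \<bar>x \<bullet> b\<bar> \<le> r / 2}"
    by (rule arg_cong[where f="\<lambda>M. emeasure M _"]) (rule lborel_eq)
  also have "\<dots> = emeasure (?M (insert b A)) ?S"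
  proof (subst emeasure_distr)
    have nrm: "norm (\<Sum>b\<in>Basis. f b *\<^sub>R b :: 'a) \<le> 1 \<longleftrightarrow> (\<Sum>i\<in>Basis. (f i)\<^sup>2) \<le> 1" for f
      by (subst euclidean_dist_l2[of 0, simplified dist_0_norm]) (auto simp: L2_set_def)
    have inn: "(\<Sum>b\<in>Basis. f b *\<^sub>R b :: 'a) \<bullet> b = f b" for f
      using b by simp
    show "emeasure (?M Basis) ((\<lambda>f. \<Sum>b\<in>Basis. f b *\<^sub>R b) -` {x::'a \<in> cball 0 1. \<bar>x \<bullet> b\<bar> \<le> r / 2} \<inter> space (?M Basis))
        = emeasure (?M (insert b A)) ?S"
      unfolding A(3)[symmetric]
      by (rule arg_cong[where f="emeasure _"]) (auto simp: nrm inn)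
    show "{x::'a \<in> cball 0 1. \<bar>x \<bullet> b\<bar> \<le> r / 2} \<in> sets borel" by measurable
    show "(\<lambda>f. \<Sum>b\<in>Basis. f b *\<^sub>R b :: 'a) \<in> ?M Basis \<rightarrow>\<^sub>M borel" by measurable
  qed
  also have "\<dots> = (\<integral>\<^sup>+ f. indicator ?S f \<partial>?M (insert b A))"
    by (rule nn_integral_indicator[OF S, symmetric])
  also have "\<dots> = (\<integral>\<^sup>+ y. \<integral>\<^sup>+ x. indicator ?S (x(b := y)) \<partial>?M A \<partial>lborel)"
    using A(1,2) by (rule product_nn_integral_insert_rev) (rule borel_measurable_indicator[OF S])
  also have "\<dots> = (\<integral>\<^sup>+ y. indicator {-(r/2)..r/2} y * (\<integral>\<^sup>+ x. indicator (?D y) x \<partial>?M A) \<partial>lborel)"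
  proof (rule nn_integral_cong)
    fix y :: real
    have "(\<integral>\<^sup>+ x. indicator ?S (x(b := y)) \<partial>?M A)
       = (\<integral>\<^sup>+ x. indicator {-(r/2)..r/2} y * indicator (?D y) x \<partial>?M A)"
    proof (rule nn_integral_cong)
      fix f assume f: "f \<in> space (?M A)"
      have "(\<Sum>x\<in>A. (if x = b then y else f x)\<^sup>2) = (\<Sum>x\<in>A. (f x)\<^sup>2)"
        using A by (intro sum.cong) auto
      with f A(1,2) show "indicator ?S (f(b := y)) = (indicator {-(r/2)..r/2} y * indicator (?D y) f :: ennreal)"
        by (auto simp: indicator_def space_PiM PiE_def)
    qed
    then show "(\<integral>\<^sup>+ x. indicator ?S (x(b := y)) \<partial>?M A)
       = indicator {-(r/2)..r/2} y * (\<integral>\<^sup>+ x. indicator (?D y) x \<partial>?M A)"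
      using A by (simp add: nn_integral_cmult)
  qed
  also have "\<dots> = (\<integral>\<^sup>+ y. ennreal (unit_ball_vol (card A) * chord (card A) y) * indicator {-(r/2)..r/2} y \<partial>lborel)"
  proof (rule nn_integral_cong_AE)
    \<comment> \<open>At the two poles the section degenerates to a ball of radius zero.\<close>
    have "AE y in lborel. y \<notin> {-1, 1::real}"
      by (intro AE_not_in countable_imp_null_set_lborel) auto
    then show "AE y in lborel. indicator {-(r/2)..r/2} y * (\<integral>\<^sup>+ x. indicator (?D y) x \<partial>?M A)
        = ennreal (unit_ball_vol (card A) * chord (card A) y) * indicator {-(r/2)..r/2} y"
    proof eventually_elim
      case (elim y)
      have "(\<integral>\<^sup>+ x. indicator (?D y) x \<partial>?M A) = emeasure (?M A) (?D y)"
        using A by (subst nn_integral_indicator) auto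
      also have "\<dots> = ennreal (unit_ball_vol (card A) * chord (card A) y)"
      proof (cases "y\<^sup>2 < 1")
        case True
        then show ?thesis
          using A by (subst emeasure_cball_aux) (auto simp: chord_def max_def)
      next
        case False
        have "\<not> y\<^sup>2 = 1"
          using elim by (auto simp: power2_eq_1_iff)
        with False have y: "1 - y\<^sup>2 < 0" by simp
        have "\<not> sqrt (\<Sum>i\<in>A. (f i)\<^sup>2) \<le> sqrt (1 - y\<^sup>2)" for f :: "'a \<Rightarrow> real"
        proof -
          have "0 \<le> (\<Sum>i\<in>A. (f i)\<^sup>2)" by (simp add: sum_nonneg)
          with y show ?thesis by simp
        qed
        moreover have "chord (card A) y = 0"
          using y dim A by (simp add: chord_def)
        ultimately show ?thesis by simp
      qed
      finally show ?case by (simp add: mult.commute)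
    qed
  qed
  also have "\<dots> = ennreal (unit_ball_vol (card A) * chord_integral (card A) (r/2)
      - unit_ball_vol (card A) * chord_integral (card A) (-(r/2)))"
    using r by (intro nn_integral_FTC_Icc DERIV_cmult[OF chord_integral_deriv] mult_nonneg_nonneg chord_nonneg
      borel_measurable_times borel_measurable_const borel_chord) auto
  also have "\<dots> = slab_volume (card A) r"
    by (simp add: slab_volume_def right_diff_distrib)
  finally show ?thesis
    by (simp only: A(4))
qed

lemma borel_slab_volume [measurable]: "slab_volume m \<in> borel_measurable borel"
  by (intro borel_measurable_continuous_onI DERIV_continuous_on)
     (rule has_field_derivative_at_within[OF slab_volume_deriv])

lemma slab_volume_0 [simp]: "slab_volume m 0 = 0"
  by (simp add: slab_volume_def)

lemma slab_volume_mono: "r \<le> s \<Longrightarrow> slab_volume m r \<le> slab_volume m s"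
  by (rule DERIV_nonneg_imp_nondecreasing)
     (auto intro!: exI slab_volume_deriv mult_nonneg_nonneg chord_nonneg)

lemma slab_volume_nonneg: "0 \<le> r \<Longrightarrow> 0 \<le> slab_volume m r"
  using slab_volume_mono[of 0 r m] by simp

lemma emeasure_slab:
  fixes u :: "real ^ 'n::finite"
  assumes u: "norm u = 1" and r: "0 \<le> r" and dim: "2 \<le> CARD('n)"
  shows "emeasure lborel {x \<in> ball 0 1. \<bar>x \<bullet> u\<bar> \<le> r / 2} = slab_volume (CARD('n) - 1) r"
proof -
  obtain b :: "real ^ 'n" where b: "b \<in> Basis" using nonempty_Basis by blast
  obtain f :: "real ^ 'n \<Rightarrow> real ^ 'n" where f: "orthogonal_transformation f" "f u = b"
    using orthogonal_transformation_exists[of u b] u b by auto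
  have "{x \<in> ball 0 1. \<bar>x \<bullet> u\<bar> \<le> r / 2} = {x. f x \<in> {x \<in> ball 0 1. \<bar>x \<bullet> b\<bar> \<le> r / 2}}"
  proof -
    have "f x \<bullet> b = x \<bullet> u" "norm (f x) = norm x" for x
      using f by (auto simp: orthogonal_transformation_def orthogonal_transformation_norm)
    then show ?thesis by simp
  qed
  then have "emeasure lborel {x \<in> ball 0 1. \<bar>x \<bullet> u\<bar> \<le> r / 2} = emeasure lborel {x \<in> ball 0 1. \<bar>x \<bullet> b\<bar> \<le> r / 2}"
    by (simp only:) (rule emeasure_lborel_orthogonal[OF f(1)], measurable)
  also have "\<dots> = emeasure lborel {x \<in> cball 0 1. \<bar>x \<bullet> b\<bar> \<le> r / 2}"
  proof (rule emeasure_eq_AE)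
    have "sphere (0 :: real ^ 'n) 1 \<in> null_sets lborel"
      using negligible_sphere[of "0 :: real ^ 'n" 1]
      by (auto simp: null_sets_completion_iff negligible_iff_null_sets)
    then have "AE x in lborel. x \<notin> sphere (0 :: real ^ 'n) 1"
      by (rule AE_not_in)
    then show "AE x in lborel. x \<in> {x \<in> ball 0 1. \<bar>x \<bullet> b\<bar> \<le> r / 2} \<longleftrightarrow> x \<in> {x \<in> cball 0 1. \<bar>x \<bullet> b\<bar> \<le> r / 2}"
      by eventually_elim auto
  qed measurable
  also have "\<dots> = slab_volume (CARD('n) - 1) r"
    using emeasure_slab_basis[OF b r] dim by simp
  finally show ?thesis .
qed

section \<open>The overlap of two translated balls\<close>

text \<open>
  Let \<open>u = z / |z|\<close> and let \<open>C\<close> be the cap of the ball where \<open>x \<bullet> u > |z| / 2\<close>. The hyperplane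
  \<open>x \<bullet> u = |z| / 2\<close> cuts the lens into \<open>C\<close> and its mirror image under \<open>x \<mapsto> z - x\<close>. The ball
  itself consists of \<open>C\<close>, its mirror image under \<open>x \<mapsto> - x\<close>, and a slab of width \<open>|z|\<close>. So lens
  plus slab has the volume of the ball.
\<close>

lemma emeasure_ball_overlap:
  fixes z :: "real ^ 'n::finite"
  assumes dim: "2 \<le> CARD('n)"
  shows "emeasure lborel {x \<in> ball 0 1. x - z \<in> ball 0 1} + slab_volume (CARD('n) - 1) (norm z)
       = emeasure lborel (ball (0 :: real ^ 'n) 1)"
proof (cases "z = 0")
  case True
  then show ?thesis by (simp add: ball_def)
next
  case False
  let ?B = "ball (0 :: real ^ 'n) 1"
  define u where "u = z /\<^sub>R norm z"
  define r where "r = norm z"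
  have r: "r > 0" and u: "norm u = 1" and z: "z = r *\<^sub>R u"
    using False by (auto simp: u_def r_def)
  have uu: "u \<bullet> u = 1" using u by (simp add: dot_square_norm)
  define C where "C = {x \<in> ?B. r / 2 < x \<bullet> u}"
  have [measurable]: "C \<in> sets borel" "?B \<in> sets borel" unfolding C_def by measurable
  have sq: "(norm (x - z))\<^sup>2 = (norm x)\<^sup>2 - 2 * r * (x \<bullet> u - r / 2)" for x
    unfolding dot_square_norm[symmetric] z
    by (simp add: algebra_simps inner_commute uu power2_eq_square)
  have near: "x - z \<in> ?B" if "x \<in> C" for x
  proof -
    have "0 \<le> 2 * r * (x \<bullet> u - r / 2)" using that r by (simp add: C_def)
    then have "(norm (x - z))\<^sup>2 \<le> (norm x)\<^sup>2" using sq[of x] by linarith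
    then have "norm (x - z) \<le> norm x" by (rule power2_le_imp_le) simp
    then show ?thesis using that by (auto simp: C_def)
  qed
  have far: "z - x \<in> C \<longleftrightarrow> x \<in> ?B \<and> x - z \<in> ?B \<and> x \<bullet> u < r / 2" for x
  proof -
    have "(z - x) \<bullet> u = r - x \<bullet> u" by (simp add: z algebra_simps uu)
    then show ?thesis
      using near[of "z - x"] by (auto simp: C_def dist_norm norm_minus_commute)
  qed
  have "emeasure lborel {x \<in> ?B. x - z \<in> ?B} = emeasure lborel (C \<union> {x. z - x \<in> C})"
  proof (rule emeasure_eq_AE)
    have "{x. u \<bullet> x = r / 2} \<in> null_sets lborel"
    proof -
      have "u \<noteq> 0" using u by auto
      then have "negligible {x. u \<bullet> x = r / 2}" by (intro negligible_hyperplane) simp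
      moreover have "{x. u \<bullet> x = r / 2} \<in> sets lborel" by measurable
      ultimately show ?thesis
        by (simp only: null_sets_completion_iff negligible_iff_null_sets)
    qed
    then have "AE x in lborel. x \<notin> {x. u \<bullet> x = r / 2}"
      by (rule AE_not_in)
    then show "AE x in lborel. x \<in> {x \<in> ?B. x - z \<in> ?B} \<longleftrightarrow> x \<in> C \<union> {x. z - x \<in> C}"
    proof eventually_elim
      case (elim x)
      then show ?case
        using near[of x] far[of x] by (auto simp: C_def inner_commute)
    qed
  qed measurable
  also have "\<dots> = emeasure lborel C + emeasure lborel {x. z - x \<in> C}"
    using far by (intro plus_emeasure[symmetric]) (auto simp: C_def)
  also have "emeasure lborel {x. z - x \<in> C} = emeasure lborel C"
    by (rule emeasure_lborel_reflect) measurable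
  finally have lens: "emeasure lborel {x \<in> ?B. x - z \<in> ?B} = emeasure lborel C + emeasure lborel C" .
  have "?B = C \<union> ({x. 0 - x \<in> C} \<union> {x \<in> ?B. \<bar>x \<bullet> u\<bar> \<le> r / 2})"
    by (auto simp: C_def)
  then have "emeasure lborel ?B = emeasure lborel (C \<union> ({x. 0 - x \<in> C} \<union> {x \<in> ?B. \<bar>x \<bullet> u\<bar> \<le> r / 2}))"
    by (rule arg_cong)
  also have "\<dots> = emeasure lborel C + emeasure lborel ({x. 0 - x \<in> C} \<union> {x \<in> ?B. \<bar>x \<bullet> u\<bar> \<le> r / 2})"
    using r by (intro plus_emeasure[symmetric]) (auto simp: C_def)
  also have "emeasure lborel ({x. 0 - x \<in> C} \<union> {x \<in> ?B. \<bar>x \<bullet> u\<bar> \<le> r / 2})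
     = emeasure lborel {x. 0 - x \<in> C} + emeasure lborel {x \<in> ?B. \<bar>x \<bullet> u\<bar> \<le> r / 2}"
    by (intro plus_emeasure[symmetric]) (auto simp: C_def)
  also have "emeasure lborel {x. 0 - x \<in> C} = emeasure lborel C"
    by (rule emeasure_lborel_reflect) measurable
  also have "emeasure lborel {x \<in> ?B. \<bar>x \<bullet> u\<bar> \<le> r / 2} = slab_volume (CARD('n) - 1) r"
    using emeasure_slab[OF u _ dim, of r] r by simp
  finally show ?thesis
    using lens by (simp add: r_def add.assoc)
qed

section \<open>Polar coordinates for radial functions\<close>

text \<open>
  The image of Lebesgue measure under the norm and the measure with density
  \<open>d \<omega>\<^sub>d r ^ (d - 1)\<close> both give \<open>\<omega>\<^sub>d a ^ d\<close> to each half-line \<open>{..a}\<close> with \<open>a \<ge> 0\<close>.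
  These half-lines generate the Borel sets.
\<close>

lemma nn_integral_radial:
  fixes f :: "real \<Rightarrow> ennreal"
  assumes [measurable]: "f \<in> borel_measurable borel"
  shows "(\<integral>\<^sup>+x. f (norm (x :: 'a :: euclidean_space)) \<partial>lborel)
    = (\<integral>\<^sup>+r. ennreal (real DIM('a) * unit_ball_vol (real DIM('a)) * r ^ (DIM('a) - 1)) * indicator {0..} r * f r \<partial>lborel)"
proof -
  let ?n = "DIM('a)"
  let ?w = "\<lambda>r. ennreal (?n * unit_ball_vol ?n * r ^ (?n - 1)) * indicator {0..} r"
  have shell: "emeasure (density lborel ?w) {..a} = emeasure (distr lborel borel (norm :: 'a \<Rightarrow> real)) {..a}" for a
  proof -
    have "emeasure (density lborel ?w) {..a}
        = (\<integral>\<^sup>+r. ennreal (?n * unit_ball_vol ?n * r ^ (?n - 1)) * indicator {0..a} r \<partial>lborel)"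
      by (subst emeasure_density) (auto intro!: nn_integral_cong simp: indicator_def)
    also have "\<dots> = emeasure lborel (cball (0::'a) a)"
    proof (cases "0 \<le> a")
      case True
      have "((\<lambda>r. unit_ball_vol ?n * r ^ ?n) has_real_derivative
              ?n * unit_ball_vol ?n * r ^ (?n - 1)) (at r)" for r
        by (auto intro!: derivative_eq_intros)
      with True show ?thesis
        by (subst nn_integral_FTC_Icc[where F="\<lambda>r. unit_ball_vol ?n * r ^ ?n"])
           (auto simp: emeasure_cball zero_power)
    qed simp
    also have "\<dots> = emeasure (distr lborel borel (norm :: 'a \<Rightarrow> real)) {..a}"
      by (subst emeasure_distr) (auto intro!: arg_cong[where f="emeasure lborel"])
    finally show ?thesis .
  qed
  have gen: "sets borel = sigma_sets UNIV (range (atMost :: real \<Rightarrow> real set))"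
    by (subst borel_eq_atMost) simp
  have "distr lborel borel (norm :: 'a \<Rightarrow> real) = density lborel ?w"
  proof (rule measure_eqI_generator_eq[where \<Omega>=UNIV and E="range atMost" and A="\<lambda>i. {..real i}"])
    show "(\<Union>i. {..real i}) = UNIV"
      using real_arch_simple by (auto simp: set_eq_iff)
    show "emeasure (distr lborel borel (norm :: 'a \<Rightarrow> real)) {..real i} \<noteq> \<infinity>" for i
    proof -
      have "emeasure (distr lborel borel (norm :: 'a \<Rightarrow> real)) {..real i} = emeasure lborel (cball (0::'a) i)"
        by (subst emeasure_distr) (auto intro!: arg_cong[where f="emeasure lborel"])
      then show ?thesis by (simp add: emeasure_cball)
    qed
    fix X :: "real set" assume "X \<in> range atMost"
    then obtain a where "X = {..a}" by auto
    then show "emeasure (distr lborel borel (norm :: 'a \<Rightarrow> real)) X = emeasure (density lborel ?w) X"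
      by (simp only: shell)
  qed (auto simp: Int_stable_def gen intro: range_eqI[where x="min _ _"])
  then have "(\<integral>\<^sup>+r. f r \<partial>distr lborel borel (norm :: 'a \<Rightarrow> real)) = (\<integral>\<^sup>+r. f r \<partial>density lborel ?w)"
    by simp
  then show ?thesis
    by (simp add: nn_integral_distr nn_integral_density)
qed

section \<open>The heat loss as an integral over displacements\<close>

lemma borel_poisson_kernel [measurable]: "poisson_kernel t \<in> borel_measurable borel"
  unfolding poisson_kernel_def[abs_def] by measurable

lemma poisson_kernel_nonneg: "0 \<le> t \<Longrightarrow> 0 \<le> poisson_kernel t x"
  by (auto simp: poisson_kernel_def kappa_def intro!: divide_nonneg_nonneg mult_nonneg_nonneg Gamma_real_nonneg)

text \<open>
  Substitute \<open>y = x - z\<close> and exchange the integrals. Unit mass and finite volume make both Bochner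
  integrals in the definition converge, so that they agree with nonnegative integrals.
\<close>

lemma heat_content_eq_nn_integral:
  fixes \<Omega> :: "(real ^ 'n::finite) set"
  assumes t: "0 \<le> t" and mass: "(\<integral>\<^sup>+z. poisson_kernel t (z :: real ^ 'n) \<partial>lborel) = 1"
    and [measurable]: "\<Omega> \<in> sets borel" and fin: "emeasure lborel \<Omega> < \<infinity>"
  shows "ennreal (heat_content \<Omega> t)
    = (\<integral>\<^sup>+z. poisson_kernel t z * emeasure lborel {x \<in> \<Omega>. x - z \<in> \<Omega>} \<partial>lborel)"
proof -
  let ?p = "poisson_kernel t :: real ^ 'n \<Rightarrow> real"
  note p [simp] = poisson_kernel_nonneg[OF t]
  define I where "I x = (LINT y:\<Omega>|lborel. ?p (x - y))" for x
  have [measurable]: "I \<in> borel_measurable borel"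
    unfolding I_def[abs_def] set_lebesgue_integral_def by measurable
  have I0: "0 \<le> I x" for x
    unfolding I_def set_lebesgue_integral_def by (intro integral_nonneg_AE) auto
  have le1: "(\<integral>\<^sup>+y. ennreal (indicator \<Omega> y * ?p (x - y)) \<partial>lborel) \<le> 1" for x
  proof -
    have "(\<integral>\<^sup>+y. ennreal (indicator \<Omega> y * ?p (x - y)) \<partial>lborel) \<le> (\<integral>\<^sup>+y. ennreal (?p (x - y)) \<partial>lborel)"
      by (intro nn_integral_mono) (auto simp: indicator_def)
    also have "\<dots> = (\<integral>\<^sup>+y. ennreal (?p y) \<partial>lborel)"
      by (rule nn_integral_lborel_reflect) measurable
    finally show ?thesis by (simp add: mass)
  qed
  have I: "ennreal (I x) = (\<integral>\<^sup>+y. ennreal (indicator \<Omega> y * ?p (x - y)) \<partial>lborel)" for x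
  proof -
    have "integrable lborel (\<lambda>y. indicator \<Omega> y * ?p (x - y))"
      using le1[of x] by (intro integrableI_nonneg) (auto intro: le_less_trans)
    then show ?thesis
      unfolding I_def set_lebesgue_integral_def by (subst nn_integral_eq_integral) auto
  qed
  have "ennreal (heat_content \<Omega> t) = ennreal (\<integral>x. indicator \<Omega> x * I x \<partial>lborel)"
    by (simp add: heat_content_def I_def set_lebesgue_integral_def)
  also have "\<dots> = (\<integral>\<^sup>+x. ennreal (indicator \<Omega> x * I x) \<partial>lborel)"
  proof (rule nn_integral_eq_integral[symmetric])
    have "(\<integral>\<^sup>+x. ennreal (indicator \<Omega> x * I x) \<partial>lborel) \<le> (\<integral>\<^sup>+x. indicator \<Omega> x \<partial>lborel)"
      using le1 I by (intro nn_integral_mono) (auto simp: indicator_def)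
    with fin show "integrable lborel (\<lambda>x. indicator \<Omega> x * I x)"
      using I0 by (intro integrableI_nonneg) (auto intro: le_less_trans)
  qed (use I0 in auto)
  also have "\<dots> = (\<integral>\<^sup>+x. indicator \<Omega> x * (\<integral>\<^sup>+y. indicator \<Omega> y * ennreal (?p (x - y)) \<partial>lborel) \<partial>lborel)"
    using I0 by (simp add: ennreal_mult I ennreal_indicator)
  also have "\<dots> = (\<integral>\<^sup>+x. indicator \<Omega> x * (\<integral>\<^sup>+z. indicator \<Omega> (x - z) * ennreal (?p z) \<partial>lborel) \<partial>lborel)"
  proof (rule nn_integral_cong)
    fix x
    have "(\<integral>\<^sup>+y. indicator \<Omega> y * ennreal (?p (x - y)) \<partial>lborel)
        = (\<integral>\<^sup>+z. indicator \<Omega> (x - z) * ennreal (?p (x - (x - z))) \<partial>lborel)"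
      by (rule nn_integral_lborel_reflect[symmetric]) measurable
    then show "indicator \<Omega> x * (\<integral>\<^sup>+y. indicator \<Omega> y * ennreal (?p (x - y)) \<partial>lborel)
        = indicator \<Omega> x * (\<integral>\<^sup>+z. indicator \<Omega> (x - z) * ennreal (?p z) \<partial>lborel)"
      by simp
  qed
  also have "\<dots> = (\<integral>\<^sup>+x. \<integral>\<^sup>+z. indicator \<Omega> x * (indicator \<Omega> (x - z) * ennreal (?p z)) \<partial>lborel \<partial>lborel)"
    by (rule nn_integral_cong, rule nn_integral_cmult[symmetric]) measurable
  also have "\<dots> = (\<integral>\<^sup>+z. \<integral>\<^sup>+x. indicator \<Omega> x * (indicator \<Omega> (x - z) * ennreal (?p z)) \<partial>lborel \<partial>lborel)"
    by (rule lborel_pair.Fubini') measurable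
  also have "\<dots> = (\<integral>\<^sup>+z. \<integral>\<^sup>+x. ennreal (?p z) * indicator {x \<in> \<Omega>. x - z \<in> \<Omega>} x \<partial>lborel \<partial>lborel)"
    by (intro nn_integral_cong) (auto simp: indicator_def)
  also have "\<dots> = (\<integral>\<^sup>+z. ?p z * emeasure lborel {x \<in> \<Omega>. x - z \<in> \<Omega>} \<partial>lborel)"
    by (subst nn_integral_cmult_indicator) auto
  finally show ?thesis .
qed

lemma heat_content_nonneg: "0 \<le> t \<Longrightarrow> 0 \<le> heat_content \<Omega> t"
  unfolding heat_content_def set_lebesgue_integral_def
  by (intro integral_nonneg_AE AE_I2 scaleR_nonneg_nonneg poisson_kernel_nonneg) auto

text \<open>
  The kernel integrates both the overlap and its defect \<open>slab_volume\<close>; by unit mass, the two add up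
  to the volume of the ball. The second part serves to recover the real difference in
  the first part from its image under \<^const>\<open>ennreal\<close>.
\<close>

lemma heat_loss_ball:
  assumes t: "0 \<le> t" and mass: "(\<integral>\<^sup>+z. poisson_kernel t (z :: real ^ 'n::finite) \<partial>lborel) = 1"
    and dim: "2 \<le> CARD('n)"
  shows "ennreal (measure lborel (ball (0::real^'n) 1) - heat_content (ball (0::real^'n) 1) t)
     = (\<integral>\<^sup>+z. ennreal (poisson_kernel t (z :: real^'n) * slab_volume (CARD('n) - 1) (norm z)) \<partial>lborel)" (is "_ = ?R")
  and "heat_content (ball (0::real^'n) 1) t \<le> measure lborel (ball (0::real^'n) 1)"
proof -
  let ?p = "poisson_kernel t :: real ^ 'n \<Rightarrow> real" and ?B = "ball (0::real^'n) 1"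
  let ?h = "heat_content ?B t"
  note p [simp] = poisson_kernel_nonneg[OF t]
  have [measurable]: "?B \<in> sets borel" by simp
  have fin: "emeasure lborel ?B = ennreal (measure lborel ?B)"
    by (simp add: emeasure_ball content_ball)
  have "ennreal ?h + ?R = (\<integral>\<^sup>+z. ?p z * emeasure lborel {x \<in> ?B. x - z \<in> ?B} \<partial>lborel) + ?R"
    using assms fin by (subst heat_content_eq_nn_integral) auto
  also have "\<dots> = (\<integral>\<^sup>+z. ?p z * emeasure lborel {x \<in> ?B. x - z \<in> ?B}
        + ennreal (?p z * slab_volume (CARD('n) - 1) (norm z)) \<partial>lborel)"
  proof (rule nn_integral_add[symmetric])
    have "(\<lambda>z. \<integral>\<^sup>+x. indicator ?B x * indicator ?B (x - z) \<partial>lborel) \<in> borel_measurable borel"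
      by measurable
    also have "(\<lambda>z. \<integral>\<^sup>+x. indicator ?B x * indicator ?B (x - z) \<partial>lborel)
       = (\<lambda>z. \<integral>\<^sup>+x. indicator {x \<in> ?B. x - z \<in> ?B} x \<partial>lborel)"
      by (intro ext nn_integral_cong) (auto simp: indicator_def)
    also have "\<dots> = (\<lambda>z. emeasure lborel {x \<in> ?B. x - z \<in> ?B})"
      by (intro ext nn_integral_indicator) measurable
    finally have [measurable]: "(\<lambda>z. emeasure lborel {x \<in> ?B. x - z \<in> ?B}) \<in> borel_measurable borel" .
    show "(\<lambda>z. ?p z * emeasure lborel {x \<in> ?B. x - z \<in> ?B}) \<in> borel_measurable lborel"
      by measurable
  qed measurable
  also have "\<dots> = (\<integral>\<^sup>+z. ?p z * emeasure lborel ?B \<partial>lborel)"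
  proof (rule nn_integral_cong)
    fix z :: "real ^ 'n"
    show "?p z * emeasure lborel {x \<in> ?B. x - z \<in> ?B} + ennreal (?p z * slab_volume (CARD('n) - 1) (norm z))
        = ?p z * emeasure lborel ?B"
      unfolding emeasure_ball_overlap[OF dim, of z, symmetric]
      by (subst ennreal_mult) (auto simp: slab_volume_nonneg distrib_left)
  qed
  also have "\<dots> = ennreal (measure lborel ?B)"
    by (simp add: nn_integral_multc mass fin)
  finally have sum: "ennreal ?h + ?R = ennreal (measure lborel ?B)" .
  then have "ennreal ?h \<le> ennreal (measure lborel ?B)"
    by (metis le_iff_add)
  then show "?h \<le> measure lborel ?B" by simp
  have "ennreal (measure lborel ?B - ?h) = ennreal (measure lborel ?B) - ennreal ?h"
    using heat_content_nonneg[OF t, of ?B] by (rule ennreal_minus[symmetric])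
  also have "\<dots> = ?R"
    unfolding sum[symmetric] by (rule ennreal_add_diff_cancel_left) simp
  finally show "ennreal (measure lborel ?B - ?h) = ?R" .
qed

section \<open>Reduction to one variable\<close>

text \<open>
  Up to the factor \<open>radial_const n * t\<close>, the density of the norm under the \<open>n\<close>-dimensional Poisson
  kernel at time \<open>t\<close>. The power of the square root replaces \<open>powr\<close>.
\<close>

definition radial_kernel :: "nat \<Rightarrow> real \<Rightarrow> real \<Rightarrow> real" where
  "radial_kernel n t r = r ^ (n - 1) / sqrt (t\<^sup>2 + r\<^sup>2) ^ (n + 1)"

text \<open>
  The product of the surface area of the unit sphere and the normalising constant of the kernel.
\<close>

definition radial_const :: "nat \<Rightarrow> real" where
  "radial_const n = n * unit_ball_vol n * kappa n"

lemma radial_kernel_nonneg: "0 \<le> r \<Longrightarrow> 0 \<le> radial_kernel n t r"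
  by (simp add: radial_kernel_def)

lemma borel_radial_kernel [measurable]: "radial_kernel n t \<in> borel_measurable borel"
  unfolding radial_kernel_def[abs_def] by measurable

lemma radial_const_2: "radial_const 2 = 1"
proof -
  have "Gamma (3 / 2 :: real) = sqrt pi / 2"
  proof -
    have "(1 / 2 :: real) \<notin> \<int>\<^sub>\<le>\<^sub>0"
      using nonpos_Ints_nonpos[of "1 / 2 :: real"] by auto
    from Gamma_plus1[OF this] show ?thesis by (simp add: Gamma_one_half_real)
  qed
  moreover have "pi powr (- (3 / 2)) = 1 / (pi * sqrt pi)"
  proof -
    have "pi powr (3 / 2) = pi * sqrt pi"
      using powr_add[of pi 1 "1 / 2"] by (simp add: powr_half_sqrt)
    then show ?thesis by (simp add: powr_minus_divide)
  qed
  ultimately show ?thesis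
    by (simp add: radial_const_def kappa_def unit_ball_vol_2)
qed

lemma radial_const_3: "radial_const 3 = 4 / pi"
proof -
  have "Gamma (2 :: real) = 1" using Gamma_fact[of 1] by simp
  moreover have "pi powr (- 2) = 1 / pi\<^sup>2"
    by (simp add: powr_minus_divide)
  ultimately show ?thesis
    by (simp add: radial_const_def kappa_def unit_ball_vol_3 power2_eq_square)
qed

lemma poisson_kernel_radial:
  assumes "0 < t"
  shows "poisson_kernel t (x :: real ^ 'n::finite) =
    kappa CARD('n) * t / sqrt (t\<^sup>2 + (norm x)\<^sup>2) ^ (CARD('n) + 1)"
proof -
  let ?s = "t\<^sup>2 + (norm x)\<^sup>2"
  have s: "?s > 0" using assms by (intro add_pos_nonneg) auto
  have "?s powr ((real CARD('n) + 1) / 2) = (?s powr (1 / 2)) powr real (CARD('n) + 1)"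
    by (simp add: powr_powr add_divide_distrib add.commute)
  also have "\<dots> = sqrt ?s ^ (CARD('n) + 1)"
    using s by (subst powr_realpow) (auto simp: powr_half_sqrt)
  finally show ?thesis by (simp add: poisson_kernel_def)
qed

lemma nn_integral_poisson_radial:
  fixes h :: "real \<Rightarrow> real"
  assumes t: "0 < t" and [measurable]: "h \<in> borel_measurable borel" and h: "\<And>r. 0 \<le> r \<Longrightarrow> 0 \<le> h r"
  shows "(\<integral>\<^sup>+z. ennreal (poisson_kernel t (z :: real ^ 'n::finite) * h (norm z)) \<partial>lborel)
     = (\<integral>\<^sup>+r. ennreal (radial_const CARD('n) * t * (radial_kernel CARD('n) t r * h r)) * indicator {0..} r \<partial>lborel)"
proof -
  let ?n = "CARD('n)"
  let ?f = "\<lambda>r. ennreal (kappa ?n * t / sqrt (t\<^sup>2 + r\<^sup>2) ^ (?n + 1) * h r)"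
  have k: "0 \<le> kappa ?n" by (auto simp: kappa_def intro!: mult_nonneg_nonneg Gamma_real_nonneg)
  have "(\<integral>\<^sup>+z. ennreal (poisson_kernel t (z :: real ^ 'n) * h (norm z)) \<partial>lborel)
      = (\<integral>\<^sup>+z. ?f (norm (z :: real ^ 'n)) \<partial>lborel)"
    by (simp only: poisson_kernel_radial[OF t])
  also have "\<dots> = (\<integral>\<^sup>+r. ennreal (real DIM(real ^ 'n) * unit_ball_vol (real DIM(real ^ 'n)) * r ^ (DIM(real ^ 'n) - 1))
       * indicator {0..} r * ?f r \<partial>lborel)"
    by (rule nn_integral_radial) measurable
  also have "\<dots> = (\<integral>\<^sup>+r. ennreal (radial_const ?n * t * (radial_kernel ?n t r * h r)) * indicator {0..} r \<partial>lborel)"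
  proof (rule nn_integral_cong)
    fix r :: real
    show "ennreal (real DIM(real ^ 'n) * unit_ball_vol (real DIM(real ^ 'n)) * r ^ (DIM(real ^ 'n) - 1))
       * indicator {0..} r * ?f r = ennreal (radial_const ?n * t * (radial_kernel ?n t r * h r)) * indicator {0..} r"
    proof (cases "0 \<le> r")
      case True
      have "ennreal (?n * unit_ball_vol ?n * r ^ (?n - 1)) * ?f r
          = ennreal (?n * unit_ball_vol ?n * r ^ (?n - 1) * (kappa ?n * t / sqrt (t\<^sup>2 + r\<^sup>2) ^ (?n + 1) * h r))"
        using True h[OF True] t k by (intro ennreal_mult[symmetric] mult_nonneg_nonneg divide_nonneg_nonneg) auto
      also have "\<dots> = ennreal (radial_const ?n * t * (radial_kernel ?n t r * h r))"
        by (simp add: radial_const_def radial_kernel_def mult_ac)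
      finally show ?thesis using True by simp
    qed simp
  qed
  finally show ?thesis .
qed

text \<open>
  That the kernel has unit mass is checked in each dimension by an explicit primitive; the one for
  dimension three involves the arctangent.
\<close>

lemma nn_integral_radial_kernel_2:
  assumes t: "0 < t"
  shows "(\<integral>\<^sup>+r. ennreal (t * radial_kernel 2 t r) * indicator {0..} r \<partial>lborel) = 1"
proof -
  have pos: "0 < t\<^sup>2 + x\<^sup>2" for x using t by (intro add_pos_nonneg) auto
  have "(\<integral>\<^sup>+r. ennreal (t * radial_kernel 2 t r) * indicator {0..} r \<partial>lborel)
      = ennreal (0 - (- t / sqrt (t\<^sup>2 + 0\<^sup>2)))"
  proof (rule nn_integral_FTC_atLeast)
    show "((\<lambda>r. - t / sqrt (t\<^sup>2 + r\<^sup>2)) has_real_derivative t * radial_kernel 2 t r) (at r)" for r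
      using pos[of r] by (auto intro!: derivative_eq_intros simp: radial_kernel_def field_simps power2_eq_square power3_eq_cube)
    show "((\<lambda>r. - t / sqrt (t\<^sup>2 + r\<^sup>2)) \<longlongrightarrow> 0) at_top"
      using t by real_asymp
  qed (use t in \<open>auto simp: radial_kernel_nonneg\<close>)
  then show ?thesis using t by simp
qed

lemma nn_integral_radial_kernel_3:
  assumes t: "0 < t"
  shows "(\<integral>\<^sup>+r. ennreal (4 / pi * t * radial_kernel 3 t r) * indicator {0..} r \<partial>lborel) = 1"
proof -
  have pos: "0 < t\<^sup>2 + x\<^sup>2" for x using t by (intro add_pos_nonneg) auto
  let ?F = "\<lambda>r. 2 / pi * (arctan (r / t) - t * r / (t\<^sup>2 + r\<^sup>2))"
  have "(\<integral>\<^sup>+r. ennreal (4 / pi * t * radial_kernel 3 t r) * indicator {0..} r \<partial>lborel)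
      = ennreal (1 - ?F 0)"
  proof (rule nn_integral_FTC_atLeast)
    fix r :: real
    have s: "sqrt (t\<^sup>2 + r\<^sup>2) ^ 4 = (t\<^sup>2 + r\<^sup>2)\<^sup>2"
      using pos[of r] by (simp add: power4_eq_xxxx power2_eq_square)
    have at: "inverse (1 + (r / t)\<^sup>2) * (1 / t) = t / (t\<^sup>2 + r\<^sup>2)"
      using t pos[of r] by (simp add: field_simps power2_eq_square)
    have "(?F has_real_derivative 2 / pi * (inverse (1 + (r / t)\<^sup>2) * (1 / t)
        - (t * (t\<^sup>2 + r\<^sup>2) - t * r * (2 * r)) / ((t\<^sup>2 + r\<^sup>2) * (t\<^sup>2 + r\<^sup>2)))) (at r)"
    proof (intro DERIV_cmult DERIV_diff)
      show "((\<lambda>r. arctan (r / t)) has_real_derivative inverse (1 + (r / t)\<^sup>2) * (1 / t)) (at r)"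
        using t by (intro DERIV_chain2[OF DERIV_arctan]) (auto intro!: derivative_eq_intros)
      show "((\<lambda>r. t * r / (t\<^sup>2 + r\<^sup>2)) has_real_derivative
          (t * (t\<^sup>2 + r\<^sup>2) - t * r * (2 * r)) / ((t\<^sup>2 + r\<^sup>2) * (t\<^sup>2 + r\<^sup>2))) (at r)"
        using pos[of r] by (auto intro!: derivative_eq_intros)
    qed
    also have "2 / pi * (inverse (1 + (r / t)\<^sup>2) * (1 / t)
        - (t * (t\<^sup>2 + r\<^sup>2) - t * r * (2 * r)) / ((t\<^sup>2 + r\<^sup>2) * (t\<^sup>2 + r\<^sup>2))) = 4 / pi * t * radial_kernel 3 t r"
    proof -
      define q where "q = t\<^sup>2 + r\<^sup>2"
      have q: "0 < q" using pos[of r] by (simp add: q_def)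
      have "t / q - (t * q - t * r * (2 * r)) / (q * q) = 2 * t * r\<^sup>2 / q\<^sup>2"
        using q by (simp add: field_simps power2_eq_square)
      then show ?thesis
        unfolding at q_def[symmetric] by (simp add: radial_kernel_def q_def[symmetric] s[folded q_def])
    qed
    finally show "(?F has_real_derivative 4 / pi * t * radial_kernel 3 t r) (at r)" .
  next
    show "(?F \<longlongrightarrow> 1) at_top"
      using t by real_asymp
  qed (use t in \<open>auto simp: radial_kernel_nonneg\<close>)
  then show ?thesis by simp
qed

lemma nn_integral_poisson_kernel:
  assumes t: "0 < t" and n: "CARD('n::finite) = 2 \<or> CARD('n) = 3"
  shows "(\<integral>\<^sup>+z. ennreal (poisson_kernel t (z :: real ^ 'n)) \<partial>lborel) = 1"
  using nn_integral_poisson_radial[OF t, of "\<lambda>_. 1", where ?'n='n] n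
    nn_integral_radial_kernel_2[OF t] nn_integral_radial_kernel_3[OF t]
  by (auto simp: radial_const_2 radial_const_3)

lemma heat_loss_radial:
  assumes t: "0 < t" and n: "CARD('n::finite) = 2 \<or> CARD('n) = 3"
  defines "X \<equiv> \<lambda>r. indicator {0..} r * (radial_kernel CARD('n) t r * slab_volume (CARD('n) - 1) r)"
  shows "integrable lborel X"
    and "measure lborel (ball (0::real^'n) 1) - heat_content (ball (0::real^'n) 1) t
       = radial_const CARD('n) * t * (\<integral>r. X r \<partial>lborel)"
proof -
  let ?n = "CARD('n)"
  let ?D = "measure lborel (ball (0::real^'n) 1) - heat_content (ball (0::real^'n) 1) t"
  have dim: "2 \<le> ?n" using n by auto
  have t0: "0 \<le> t" using t by simp
  have c: "0 < radial_const ?n * t" using n t by (auto simp: radial_const_2 radial_const_3)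
  have [measurable]: "X \<in> borel_measurable borel"
    unfolding X_def by measurable
  have X0: "0 \<le> X r" for r
    by (auto simp: X_def indicator_def radial_kernel_nonneg slab_volume_nonneg)
  have "ennreal ?D = (\<integral>\<^sup>+r. ennreal (radial_const ?n * t * (radial_kernel ?n t r * slab_volume (?n - 1) r))
      * indicator {0..} r \<partial>lborel)"
    unfolding heat_loss_ball(1)[OF t0 nn_integral_poisson_kernel[OF t n] dim]
    by (rule nn_integral_poisson_radial[OF t]) (auto simp: slab_volume_nonneg)
  also have "\<dots> = (\<integral>\<^sup>+r. ennreal (radial_const ?n * t * X r) \<partial>lborel)"
    by (intro nn_integral_cong) (auto simp: X_def indicator_def)
  finally have D: "ennreal ?D = (\<integral>\<^sup>+r. ennreal (radial_const ?n * t * X r) \<partial>lborel)" .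
  have int: "integrable lborel (\<lambda>r. radial_const ?n * t * X r)"
    using c X0 D[symmetric] by (intro integrableI_nonneg) auto
  then show "integrable lborel X"
  proof -
    have "radial_const ?n \<noteq> 0" using n by (auto simp: radial_const_2 radial_const_3)
    then show ?thesis using int t by simp
  qed
  have "ennreal ?D = ennreal (\<integral>r. radial_const ?n * t * X r \<partial>lborel)"
    unfolding D using int c X0 by (intro nn_integral_eq_integral) auto
  moreover have "0 \<le> ?D"
    using heat_loss_ball(2)[OF t0 nn_integral_poisson_kernel[OF t n] dim] by simp
  moreover have "0 \<le> (\<integral>r. radial_const ?n * t * X r \<partial>lborel)"
    using c X0 by (intro integral_nonneg_AE) auto
  ultimately have "?D = (\<integral>r. radial_const ?n * t * X r \<partial>lborel)"
    by simp
  then show "?D = radial_const ?n * t * (\<integral>r. X r \<partial>lborel)" by simp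
qed

section \<open>The regular part of the radial integral\<close>

lemma slab_volume_const:
  assumes m: "0 < m" and r: "2 \<le> r"
  shows "slab_volume m r = slab_volume m 2"
proof (cases "r = 2")
  case False
  with r have "2 < r" by simp
  from MVT2[OF this, of "slab_volume m" "\<lambda>x. unit_ball_vol m * chord m (x / 2)"] slab_volume_deriv
  obtain z where z: "2 < z" "slab_volume m r - slab_volume m 2 = (r - 2) * (unit_ball_vol m * chord m (z / 2))"
    by blast
  have "1 \<le> (z / 2)\<^sup>2" using z mult_mono[of 2 z 2 z] by (simp add: power2_eq_square)
  then have "chord m (z / 2) = 0" using m by (simp add: chord_def)
  with z show ?thesis by simp
qed simp

text \<open>
  No section of the ball is larger than the central one. The linear bound gives the remainder a
  constant sign below \<open>2\<close>, so that its integrability follows from the existence of a primitive.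
\<close>

lemma slab_volume_le_linear:
  assumes "0 \<le> r"
  shows "slab_volume m r \<le> unit_ball_vol m * r"
proof -
  have le: "chord m v \<le> 1" for v
    unfolding chord_def by (intro power_le_one) auto
  have "unit_ball_vol m * 0 - slab_volume m 0 \<le> unit_ball_vol m * r - slab_volume m r"
  proof (rule DERIV_nonneg_imp_nondecreasing[OF assms])
    show "\<exists>y. ((\<lambda>r. unit_ball_vol m * r - slab_volume m r) has_real_derivative y) (at x) \<and> 0 \<le> y" for x
      using le[of "x / 2"]
      by (intro exI[of _ "unit_ball_vol m - unit_ball_vol m * chord m (x / 2)"] conjI)
         (auto intro!: derivative_eq_intros slab_volume_deriv simp: mult_left_le)
  qed
  then show ?thesis by simp
qed

text \<open>
  The function \<open>(S(r) - \<omega> r 1\<^bsub>r < 2\<^esub>) / r\<^sup>2\<close> on the positive half-line, where \<open>S\<close> is the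
  slab volume and \<open>\<omega> r\<close> its linearisation at \<open>0\<close>. From \<open>2\<close> on, the slab is the whole ball and
  \<open>S\<close> is constant.
\<close>

definition slab_remainder :: "nat \<Rightarrow> real \<Rightarrow> real" where
  "slab_remainder m r = indicator {2..} r * (slab_volume m 2 / r\<^sup>2)
     - indicator {0<..<2} r * ((unit_ball_vol m * r - slab_volume m r) / r\<^sup>2)"

text \<open>
  Integration by parts: on \<open>(0, 2)\<close> the function \<open>(\<omega> r - S(r)) / r\<^sup>2\<close> has the primitive
  \<open>- (\<omega> r - S(r)) / r - \<omega> \<Psi>(r / 2)\<close>, since \<open>S'(r) = \<omega> chord (r / 2)\<close>. The boundary
  term at \<open>2\<close> contains \<open>S(2) / 2\<close>, which cancels against the integral of \<open>S(2) / r\<^sup>2\<close> over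
  \<open>[2, \<infinity>)\<close>; so the volume of the ball does not occur in the result.
\<close>

lemma has_bochner_integral_slab_remainder:
  fixes \<Psi> :: "real \<Rightarrow> real"
  assumes cont: "continuous_on {0..1} \<Psi>"
    and deriv: "\<And>s. 0 < s \<Longrightarrow> s < 1 \<Longrightarrow> (\<Psi> has_real_derivative (chord m s - 1) / s) (at s)"
  shows "has_bochner_integral lborel (slab_remainder m) (unit_ball_vol m * (1 + (\<Psi> 1 - \<Psi> 0)))"
proof -
  let ?a = "unit_ball_vol m" and ?S = "slab_volume m"
  have outer: "has_bochner_integral lborel (\<lambda>r. indicator {2..} r * (?S 2 / r\<^sup>2)) (?S 2 / 2)"
  proof (rule has_bochner_integral_nn_integral)
    have "(\<integral>\<^sup>+r. ennreal (?S 2 / r\<^sup>2) * indicator {2..} r \<partial>lborel) = ennreal (0 - (- ?S 2 / 2))"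
    proof (rule nn_integral_FTC_atLeast[where F="\<lambda>r. - ?S 2 / r"])
      show "((\<lambda>r. - ?S 2 / r) has_real_derivative ?S 2 / r\<^sup>2) (at r)" if "2 \<le> r" for r
        using that by (auto intro!: derivative_eq_intros simp: power2_eq_square)
      show "((\<lambda>r. - ?S 2 / r) \<longlongrightarrow> 0) at_top"
        by real_asymp
    qed (auto simp: slab_volume_nonneg)
    moreover have "(\<integral>\<^sup>+r. ennreal (indicator {2..} r * (?S 2 / r\<^sup>2)) \<partial>lborel)
        = (\<integral>\<^sup>+r. ennreal (?S 2 / r\<^sup>2) * indicator {2..} r \<partial>lborel)"
      by (intro nn_integral_cong) (auto simp: indicator_def)
    ultimately show "(\<integral>\<^sup>+r. ennreal (indicator {2..} r * (?S 2 / r\<^sup>2)) \<partial>lborel) = ennreal (?S 2 / 2)"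
      by simp
  qed (auto simp: slab_volume_nonneg)
  define f where "f r = (?a * r - ?S r) / r\<^sup>2" for r
  define F where "F r = - ((?a * r - ?S r) / r) - ?a * \<Psi> (r / 2)" for r
  have dS: "(?S has_real_derivative ?a * chord m (r / 2)) (at r)" for r
    by (rule slab_volume_deriv)
  have cS: "isCont ?S r" for r using dS by (rule DERIV_isCont)
  have dF: "(F has_real_derivative f r) (at r)" if r: "0 < r" "r < 2" for r
  proof -
    have d\<Psi>: "((\<lambda>r. \<Psi> (r / 2)) has_real_derivative (chord m (r / 2) - 1) / (r / 2) * (1 / 2)) (at r)"
      using r by (intro DERIV_chain2[OF deriv]) (auto intro!: derivative_eq_intros)
    show ?thesis
      unfolding F_def[abs_def]
      apply (rule derivative_eq_intros dS d\<Psi> | use r in simp)+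
      using r by (simp add: f_def field_simps power2_eq_square)
  qed
  have lim0: "(F \<longlongrightarrow> - ?a * \<Psi> 0) (at_right 0)"
  proof -
    \<comment> \<open>The first term of \<open>F\<close> vanishes at \<open>0\<close> because \<open>?a\<close> is the derivative of \<open>?S\<close> there.\<close>
    have "((\<lambda>r. (?S r - ?S 0) / (r - 0)) \<longlongrightarrow> ?a * chord m (0 / 2)) (at 0)"
      using dS[of 0] by (simp add: has_field_derivative_iff)
    then have "((\<lambda>r. ?S r / r) \<longlongrightarrow> ?a) (at_right 0)"
      by (simp add: chord_def filterlim_at_split)
    moreover have "((\<lambda>r. \<Psi> (r / 2)) \<longlongrightarrow> \<Psi> 0) (at_right 0)"
    proof -
      have "continuous_on {0..2} (\<lambda>r. \<Psi> (r / 2))"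
        by (intro continuous_on_compose2[OF cont] continuous_intros) auto
      then have "((\<lambda>r. \<Psi> (r / 2)) \<longlongrightarrow> \<Psi> (0 / 2)) (at 0 within {0..2})"
        unfolding continuous_on_def by (rule bspec) simp
      then show ?thesis by (simp add: at_within_Icc_at_right)
    qed
    ultimately have "((\<lambda>r. - (?a - ?S r / r) - ?a * \<Psi> (r / 2)) \<longlongrightarrow> - (?a - ?a) - ?a * \<Psi> 0) (at_right 0)"
      by (intro tendsto_intros)
    moreover have "eventually (\<lambda>r. - (?a - ?S r / r) - ?a * \<Psi> (r / 2) = F r) (at_right 0)"
      by (intro eventually_at_rightI[of 0 1]) (auto simp: F_def field_simps)
    ultimately show ?thesis
      by (simp add: Lim_transform_eventually)
  qed
  have lim2: "(F \<longlongrightarrow> - ((?a * 2 - ?S 2) / 2) - ?a * \<Psi> 1) (at_left 2)"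
  proof -
    have "continuous_on {1..2} F"
      unfolding F_def[abs_def]
      by (intro continuous_intros continuous_on_compose2[OF cont] continuous_at_imp_continuous_on)
         (auto intro: cS)
    then have "(F \<longlongrightarrow> F 2) (at 2 within {1..2})"
      by (auto simp: continuous_on_def)
    then show ?thesis by (simp add: at_within_Icc_at_left F_def)
  qed
  have dF': "(F has_real_derivative f r) (at r)" if "ereal 0 < ereal r" "ereal r < ereal 2" for r
    using that by (intro dF) auto
  have cf: "isCont f r" if "ereal 0 < ereal r" "ereal r < ereal 2" for r
    using that unfolding f_def[abs_def] by (intro continuous_intros cS) auto
  have f0: "AE r in lborel. ereal 0 < ereal r \<longrightarrow> ereal r < ereal 2 \<longrightarrow> 0 \<le> f r"
    using slab_volume_le_linear[of _ m] by (auto simp: f_def)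
  have "set_integrable lborel (einterval (ereal 0) (ereal 2)) f"
      "(LBINT x=ereal 0..ereal 2. f x) = (- ((?a * 2 - ?S 2) / 2) - ?a * \<Psi> 1) - (- ?a * \<Psi> 0)"
    using lim0 lim2 interval_integral_FTC_nonneg[OF _ dF' cf f0, of "- ?a * \<Psi> 0" "- ((?a * 2 - ?S 2) / 2) - ?a * \<Psi> 1"]
    by (simp_all add: ereal_tendsto_simps)
  then have inner: "has_bochner_integral lborel (\<lambda>r. indicator {0<..<2} r * f r)
      ((- ((?a * 2 - ?S 2) / 2) - ?a * \<Psi> 1) - (- ?a * \<Psi> 0))"
    by (simp add: has_bochner_integral_iff set_integrable_def set_lebesgue_integral_def
        interval_lebesgue_integral_def)
  have "has_bochner_integral lborel (\<lambda>r. indicator {2..} r * (?S 2 / r\<^sup>2) - indicator {0<..<2} r * f r)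
      (?S 2 / 2 - ((- ((?a * 2 - ?S 2) / 2) - ?a * \<Psi> 1) - (- ?a * \<Psi> 0)))"
    by (rule has_bochner_integral_diff[OF outer inner])
  also have "?S 2 / 2 - ((- ((?a * 2 - ?S 2) / 2) - ?a * \<Psi> 1) - (- ?a * \<Psi> 0)) = ?a * (1 + (\<Psi> 1 - \<Psi> 0))"
    by (simp add: field_simps)
  finally show ?thesis
    by (simp add: slab_remainder_def[abs_def] f_def)
qed

text \<open>
  Let \<open>w\<^sub>t(r) = (r / sqrt (t\<^sup>2 + r\<^sup>2)) ^ (n + 1)\<close>, so that the radial kernel is \<open>w\<^sub>t(r) / r\<^sup>2\<close>.
  The difference on the left is the integral of \<open>w\<^sub>t\<close> times the remainder, and \<open>w\<^sub>t\<close> is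
  bounded by \<open>1\<close> and tends to \<open>1\<close>. Dominated convergence applies.
\<close>

lemma radial_integral_remainder_tendsto:
  assumes n: "2 \<le> n"
    and X: "\<And>t. 0 < t \<Longrightarrow> integrable lborel (\<lambda>r. indicator {0..} r * (radial_kernel n t r * slab_volume (n - 1) r))"
    and I: "\<And>t. 0 < t \<Longrightarrow> has_bochner_integral lborel (\<lambda>r. radial_kernel n t r * r * indicator {0..2} r) (I t)"
    and R: "has_bochner_integral lborel (slab_remainder (n - 1)) D"
  shows "((\<lambda>t. (\<integral>r. indicator {0..} r * (radial_kernel n t r * slab_volume (n - 1) r) \<partial>lborel)
      - unit_ball_vol (n - 1) * I t) \<longlongrightarrow> D) (at_right 0)"
proof -
  let ?a = "unit_ball_vol (n - 1)" and ?S = "slab_volume (n - 1)" and ?G = "slab_remainder (n - 1)"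
  let ?X = "\<lambda>t r. indicator {0..} r * (radial_kernel n t r * ?S r)"
  define w where "w t r = \<bar>r\<bar> ^ (n + 1) / sqrt (t\<^sup>2 + r\<^sup>2) ^ (n + 1)" for t r :: real
  have [measurable]: "?G \<in> borel_measurable borel" "w t \<in> borel_measurable borel" for t
    unfolding slab_remainder_def[abs_def] w_def[abs_def] by measurable
  have w1: "\<bar>w t r\<bar> \<le> 1" for t r
  proof -
    have "\<bar>r\<bar> \<le> sqrt (t\<^sup>2 + r\<^sup>2)" by (rule real_le_rsqrt) simp
    then have "\<bar>r\<bar> ^ (n + 1) \<le> sqrt (t\<^sup>2 + r\<^sup>2) ^ (n + 1)" by (intro power_mono) auto
    moreover have "\<bar>p / d\<bar> \<le> 1" if "0 \<le> p" "p \<le> d" for p d :: real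
      using that by (cases "d = 0") (auto simp: divide_le_eq_1_pos)
    ultimately show ?thesis
      unfolding w_def by simp
  qed
  have eq: "(\<integral>r. ?X t r \<partial>lborel) - ?a * I t = (\<integral>r. w t r * ?G r \<partial>lborel)" if t: "0 < t" for t
  proof -
    have "(\<integral>r. ?X t r \<partial>lborel) - ?a * I t
        = (\<integral>r. ?X t r - ?a * (radial_kernel n t r * r * indicator {0..2} r) \<partial>lborel)"
      using X[OF t] I[OF t] by (simp add: has_bochner_integral_iff)
    also have "\<dots> = (\<integral>r. w t r * ?G r \<partial>lborel)"
    proof (rule integral_cong_AE)
      \<comment> \<open>At \<open>2\<close> the linear term still counts on the left but not in the remainder.\<close>
      have "AE r in lborel. r \<noteq> (2::real)" by (rule AE_lborel_singleton)
      then show "AE r in lborel. ?X t r - ?a * (radial_kernel n t r * r * indicator {0..2} r) = w t r * ?G r"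
      proof eventually_elim
        case (elim r)
        have w: "w t r * (c / r\<^sup>2) = radial_kernel n t r * c" if "0 < r" for c
        proof -
          have "r ^ (n + 1) = r ^ (n - 1) * r\<^sup>2"
            using n by (simp flip: power_add)
          then show ?thesis using that by (simp add: w_def radial_kernel_def)
        qed
        consider "r < 0" | "r = 0" | "0 < r" "r < 2" | "2 < r" using elim by linarith
        then show ?case
        proof cases
          case 3
          then have "w t r * ?G r = - (w t r * ((?a * r - ?S r) / r\<^sup>2))"
            by (simp add: slab_remainder_def)
          also have "\<dots> = - (radial_kernel n t r * (?a * r - ?S r))"
            by (subst w) (use 3 in auto)
          finally show ?thesis using 3 by (simp add: algebra_simps)
        next
          case 4
          then have "w t r * ?G r = w t r * (?S 2 / r\<^sup>2)"
            by (simp add: slab_remainder_def)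
          also have "\<dots> = radial_kernel n t r * ?S 2"
            by (rule w) (use 4 in auto)
          also have "?S 2 = ?S r"
            using n 4 by (intro slab_volume_const[symmetric]) auto
          finally show ?thesis using 4 by simp
        qed (use n in \<open>simp_all add: slab_remainder_def radial_kernel_def\<close>)
      qed
    qed measurable
    finally show ?thesis .
  qed
  \<comment> \<open>Dominated convergence is applied along \<open>x = 1 / t\<close> tending to infinity.\<close>
  have "((\<lambda>x. \<integral>r. w (inverse x) r * ?G r \<partial>lborel) \<longlongrightarrow> (\<integral>r. ?G r \<partial>lborel)) at_top"
  proof (rule integral_dominated_convergence_at_top[where w="\<lambda>r. norm (?G r)"])
    show "integrable lborel (\<lambda>r. norm (?G r))"
      using R by (auto simp: has_bochner_integral_iff)
    show "\<forall>\<^sub>F x in at_top. AE r in lborel. norm (w (inverse x) r * ?G r) \<le> norm (?G r)"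
      using w1 by (auto simp: abs_mult intro!: always_eventually mult_left_le_one_le)
    have "AE r in lborel. r \<noteq> (0::real)" by (rule AE_lborel_singleton)
    then show "AE r in lborel. ((\<lambda>x. w (inverse x) r * ?G r) \<longlongrightarrow> ?G r) at_top"
    proof eventually_elim
      case (elim r)
      have "((\<lambda>x. w (inverse x) r) \<longlongrightarrow> \<bar>r\<bar> ^ (n + 1) / sqrt (0\<^sup>2 + r\<^sup>2) ^ (n + 1)) at_top"
        unfolding w_def using elim by (intro tendsto_intros tendsto_inverse_0_at_top filterlim_ident) auto
      then have "((\<lambda>x. w (inverse x) r) \<longlongrightarrow> 1) at_top"
        using elim by simp
      from tendsto_mult[OF this tendsto_const[of "?G r"]] show ?case by simp
    qed
  qed measurable
  then have "((\<lambda>t. \<integral>r. w t r * ?G r \<partial>lborel) \<longlongrightarrow> D) (at_right 0)"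
    using R by (simp add: filterlim_at_right_to_top has_bochner_integral_iff)
  moreover have "eventually (\<lambda>t. (\<integral>r. w t r * ?G r \<partial>lborel) = (\<integral>r. ?X t r \<partial>lborel) - ?a * I t) (at_right 0)"
    using eq by (intro eventually_at_rightI[of 0 1]) auto
  ultimately show ?thesis
    by (rule Lim_transform_eventually)
qed

text \<open>
  The logarithm stems from \<open>I t\<close> alone, so its coefficient is
  \<open>radial_const CARD('n) * unit_ball_vol (CARD('n) - 1)\<close>. The functions \<open>\<Psi>\<close> and \<open>I\<close> are
  left as parameters because their closed forms depend on the dimension.
\<close>

lemma heat_loss_expansion:
  fixes \<Psi> I :: "real \<Rightarrow> real"
  assumes n: "CARD('n::finite) = 2 \<or> CARD('n) = 3"
    and cont: "continuous_on {0..1} \<Psi>"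
    and deriv: "\<And>s. 0 < s \<Longrightarrow> s < 1 \<Longrightarrow> (\<Psi> has_real_derivative (chord (CARD('n) - 1) s - 1) / s) (at s)"
    and I: "\<And>t. 0 < t \<Longrightarrow> has_bochner_integral lborel (\<lambda>r. radial_kernel CARD('n) t r * r * indicator {0..2} r) (I t)"
    and limI: "((\<lambda>t. I t - ln (1 / t)) \<longlongrightarrow> c) (at_right 0)"
    and s: "s = radial_const CARD('n) * unit_ball_vol (CARD('n) - 1)"
  shows "((\<lambda>t. (1 / t) * (measure lborel (ball (0::real^'n) 1) - heat_content (ball (0::real^'n) 1) t
              - s * t * ln (1 / t))) \<longlongrightarrow> s * (1 + (\<Psi> 1 - \<Psi> 0) + c)) (at_right 0)"
proof -
  let ?n = "CARD('n)" and ?a = "unit_ball_vol (CARD('n) - 1)" and ?K = "radial_const CARD('n)"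
  let ?X = "\<lambda>t. \<integral>r. indicator {0..} r * (radial_kernel ?n t r * slab_volume (?n - 1) r) \<partial>lborel"
  have "((\<lambda>t. ?X t - ?a * I t) \<longlongrightarrow> ?a * (1 + (\<Psi> 1 - \<Psi> 0))) (at_right 0)"
    using n by (intro radial_integral_remainder_tendsto I heat_loss_radial(1)
      has_bochner_integral_slab_remainder cont deriv) auto
  from tendsto_add[OF tendsto_mult[OF tendsto_const[of ?K] this] tendsto_mult[OF tendsto_const[of s] limI]]
  have "((\<lambda>t. ?K * (?X t - ?a * I t) + s * (I t - ln (1 / t))) \<longlongrightarrow> s * (1 + (\<Psi> 1 - \<Psi> 0) + c)) (at_right 0)"
    by (simp add: s algebra_simps)
  moreover have "eventually (\<lambda>t. ?K * (?X t - ?a * I t) + s * (I t - ln (1 / t))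
     = (1 / t) * (measure lborel (ball (0::real^'n) 1) - heat_content (ball (0::real^'n) 1) t
              - s * t * ln (1 / t))) (at_right 0)"
  proof (intro eventually_at_rightI[of 0 1])
    fix t :: real assume "t \<in> {0<..<1}"
    then have t: "0 < t" by simp
    show "?K * (?X t - ?a * I t) + s * (I t - ln (1 / t))
     = (1 / t) * (measure lborel (ball (0::real^'n) 1) - heat_content (ball (0::real^'n) 1) t
              - s * t * ln (1 / t))"
      unfolding heat_loss_radial(2)[OF t n] using t by (simp add: s field_simps)
  qed simp
  ultimately show ?thesis by (rule Lim_transform_eventually)
qed

section \<open>Explicit integrals in dimensions two and three\<close>

lemma near_field_integral_2:
  assumes t: "0 < t"
  shows "has_bochner_integral lborel (\<lambda>r. radial_kernel 2 t r * r * indicator {0..2} r)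
    (ln (2 + sqrt (t\<^sup>2 + 2\<^sup>2)) - 2 / sqrt (t\<^sup>2 + 2\<^sup>2) - ln t)"
proof -
  let ?F = "\<lambda>r. ln (r + sqrt (t\<^sup>2 + r\<^sup>2)) - r / sqrt (t\<^sup>2 + r\<^sup>2)"
  have pos: "0 < t\<^sup>2 + x\<^sup>2" for x using t by (intro add_pos_nonneg) auto
  have "has_bochner_integral lborel (\<lambda>r. radial_kernel 2 t r * r * indicator {0..2} r) (?F 2 - ?F 0)"
  proof (rule has_bochner_integral_FTC_Icc_nonneg)
    fix r :: real assume r: "r \<in> {0..2}"
    define q where "q = sqrt (t\<^sup>2 + r\<^sup>2)"
    have q: "q > 0" "q\<^sup>2 = t\<^sup>2 + r\<^sup>2" using pos[of r] by (auto simp: q_def)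
    have "(?F has_real_derivative (1 + r / q) / (r + q) - (q - r * (r / q)) / (q * q)) (at r)"
    proof -
      have dq: "((\<lambda>r. sqrt (t\<^sup>2 + r\<^sup>2)) has_real_derivative r / q) (at r)"
      proof -
        have "((\<lambda>r. t\<^sup>2 + r\<^sup>2) has_real_derivative 2 * r) (at r)"
          by (auto intro!: derivative_eq_intros)
        from DERIV_chain2[OF DERIV_real_sqrt[OF pos[of r]] this] show ?thesis
          by (rule DERIV_cong) (use t in \<open>simp add: q_def divide_simps\<close>)
      qed
      have "0 < r + q" using r q(1) by simp
      then have "((\<lambda>r. ln (r + sqrt (t\<^sup>2 + r\<^sup>2))) has_real_derivative 1 / (r + q) * (1 + r / q)) (at r)"
        unfolding q_def by (intro DERIV_chain2[OF DERIV_ln_divide] DERIV_add DERIV_ident dq[unfolded q_def])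
      moreover have "((\<lambda>r. r / sqrt (t\<^sup>2 + r\<^sup>2)) has_real_derivative (1 * q - r * (r / q)) / (q * q)) (at r)"
        using t unfolding q_def by (intro DERIV_divide DERIV_ident dq[unfolded q_def]) auto
      ultimately show ?thesis
        by (rule DERIV_diff[THEN DERIV_cong]) simp
    qed
    also have "(1 + r / q) / (r + q) - (q - r * (r / q)) / (q * q) = radial_kernel 2 t r * r"
    proof -
      have "0 < r + q" using r q(1) by simp
      then have "(1 + r / q) / (r + q) = 1 / q" using q(1) by (simp add: divide_simps)
      then have "(1 + r / q) / (r + q) - (q - r * (r / q)) / (q * q) = 1 / q - (q - r * (r / q)) / (q * q)"
        by simp
      also have "\<dots> = r * r / q ^ 3"
        using q(1) by (simp add: field_simps power3_eq_cube)
      also have "\<dots> = radial_kernel 2 t r * r"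
        by (simp add: radial_kernel_def q_def)
      finally show ?thesis .
    qed
    finally show "(?F has_real_derivative radial_kernel 2 t r * r) (at r)" .
  qed (auto simp: radial_kernel_nonneg)
  then show ?thesis using t by (simp add: algebra_simps)
qed

lemma near_field_integral_3:
  assumes t: "0 < t"
  shows "has_bochner_integral lborel (\<lambda>r. radial_kernel 3 t r * r * indicator {0..2} r)
    ((ln (t\<^sup>2 + 2\<^sup>2) + t\<^sup>2 / (t\<^sup>2 + 2\<^sup>2) - 2 * ln t - 1) / 2)"
proof -
  let ?F = "\<lambda>r. (ln (t\<^sup>2 + r\<^sup>2) + t\<^sup>2 / (t\<^sup>2 + r\<^sup>2)) / 2"
  have pos: "0 < t\<^sup>2 + x\<^sup>2" for x using t by (intro add_pos_nonneg) auto
  have "has_bochner_integral lborel (\<lambda>r. radial_kernel 3 t r * r * indicator {0..2} r) (?F 2 - ?F 0)"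
  proof (rule has_bochner_integral_FTC_Icc_nonneg)
    fix r :: real assume r: "r \<in> {0..2}"
    define q where "q = t\<^sup>2 + r\<^sup>2"
    have q: "q > 0" using pos[of r] by (auto simp: q_def)
    have s: "sqrt q ^ 4 = q * q"
      using q by (simp add: power4_eq_xxxx)
    have "(?F has_real_derivative (2 * r / q - t\<^sup>2 * (2 * r) / (q * q)) / 2) (at r)"
      using q unfolding q_def by (auto intro!: derivative_eq_intros)
    also have "(2 * r / q - t\<^sup>2 * (2 * r) / (q * q)) / 2 = r * (q - t\<^sup>2) / (q * q)"
      using q by (simp add: field_simps)
    also have "\<dots> = radial_kernel 3 t r * r"
      by (simp add: radial_kernel_def q_def[symmetric] s) (simp add: q_def power2_eq_square)
    finally show "(?F has_real_derivative radial_kernel 3 t r * r) (at r)" .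
  qed (auto simp: radial_kernel_nonneg)
  then show ?thesis using t by (simp add: ln_realpow algebra_simps diff_divide_distrib add_divide_distrib)
qed

section \<open>The two-term expansion of the heat content\<close>

theorem proposition4p1:
  fixes B :: "(real ^ 'n::finite) set"
  assumes "CARD('n) = 2 \<or> CARD('n) = 3"
    and "B = ball 0 1"
  shows "((\<lambda>t. (1 / t) *
            (measure lborel B - heat_content B t
              - surface_area (sphere (0 :: real ^ 'n) 1) / pi * t * ln (1 / t)))
          \<longlongrightarrow> (if CARD('n) = 2 then 6 * ln 2 - 2 else 4 * ln 2)) (at_right 0)"
  using assms(1)
proof
  assume n: "CARD('n) = 2"
  \<comment> \<open>In dimension two the primitive of \<open>(sqrt (1 - s\<^sup>2) - 1) / s = - s / (1 + sqrt (1 - s\<^sup>2))\<close> is:\<close>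
  let ?\<Psi> = "\<lambda>s::real. sqrt (1 - s\<^sup>2) - ln (1 + sqrt (1 - s\<^sup>2))"
  have area: "surface_area (sphere (0 :: real ^ 'n) 1) / pi = 2"
    by (simp add: surface_area_unit_sphere content_ball n unit_ball_vol_2)
  have "((\<lambda>t. (1 / t) * (measure lborel (ball (0::real^'n) 1) - heat_content (ball (0::real^'n) 1) t
              - 2 * t * ln (1 / t))) \<longlongrightarrow> 2 * (1 + (?\<Psi> 1 - ?\<Psi> 0) + (2 * ln 2 - 1))) (at_right 0)"
  proof (rule heat_loss_expansion)
    show "continuous_on {0..1} ?\<Psi>"
    proof (intro continuous_intros ballI)
      fix x :: real assume "x \<in> {0..1}"
      then have "x\<^sup>2 \<le> 1" by (simp add: abs_square_le_1)
      then show "1 + sqrt (1 - x\<^sup>2) \<noteq> 0"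
        using real_sqrt_ge_zero[of "1 - x\<^sup>2"] by linarith
    qed
    show "(?\<Psi> has_real_derivative (chord (CARD('n) - 1) s - 1) / s) (at s)" if s: "0 < s" "s < 1" for s
    proof -
      define q where "q = sqrt (1 - s\<^sup>2)"
      have "s\<^sup>2 < 1" using s by (simp add: abs_square_less_1)
      then have q: "q > 0" "q\<^sup>2 = 1 - s\<^sup>2" by (auto simp: q_def)
      have "(?\<Psi> has_real_derivative - s / q - (- s / q) / (1 + q)) (at s)"
        using q(1) \<open>s\<^sup>2 < 1\<close> unfolding q_def
        by (auto intro!: derivative_eq_intros add_pos_pos simp: divide_simps)
      also have "- s / q - (- s / q) / (1 + q) = - s / (1 + q)"
        using q(1) by (simp add: divide_simps) (simp add: algebra_simps)
      also have "\<dots> = (q - 1) / s"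
        using s q by (simp add: divide_simps) (simp add: algebra_simps power2_eq_square)
      also have "q = chord (CARD('n) - 1) s"
        using \<open>s\<^sup>2 < 1\<close> by (simp add: chord_def n q_def)
      finally show ?thesis .
    qed
    show "has_bochner_integral lborel (\<lambda>r. radial_kernel CARD('n) t r * r * indicator {0..2} r)
        (ln (2 + sqrt (t\<^sup>2 + 2\<^sup>2)) - 2 / sqrt (t\<^sup>2 + 2\<^sup>2) - ln t)" if "0 < t" for t
      unfolding n by (rule near_field_integral_2[OF that])
    show "((\<lambda>t. ln (2 + sqrt (t\<^sup>2 + 2\<^sup>2)) - 2 / sqrt (t\<^sup>2 + 2\<^sup>2) - ln t - ln (1 / t))
        \<longlongrightarrow> 2 * ln 2 - 1) (at_right (0::real))"
    proof -
      have ln4: "2 * ln 2 = ln (4 :: real)" using ln_realpow[of 2 2] by simp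
      show ?thesis unfolding ln4 by real_asymp
    qed
  qed (use n in \<open>auto simp: radial_const_2\<close>)
  then show ?thesis
    using area n assms(2) by (simp add: algebra_simps)
next
  assume n: "CARD('n) = 3"
  \<comment> \<open>In dimension three \<open>(chord 2 s - 1) / s\<close> is just \<open>- s\<close>.\<close>
  let ?\<Psi> = "\<lambda>s::real. - (s\<^sup>2 / 2)"
  have area: "surface_area (sphere (0 :: real ^ 'n) 1) / pi = 4"
    by (simp add: surface_area_unit_sphere content_ball n unit_ball_vol_3)
  have "((\<lambda>t. (1 / t) * (measure lborel (ball (0::real^'n) 1) - heat_content (ball (0::real^'n) 1) t
              - 4 * t * ln (1 / t))) \<longlongrightarrow> 4 * (1 + (?\<Psi> 1 - ?\<Psi> 0) + (ln 2 - 1 / 2))) (at_right 0)"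
  proof (rule heat_loss_expansion)
    show "continuous_on {0..1} ?\<Psi>"
      by (intro continuous_intros) auto
    show "(?\<Psi> has_real_derivative (chord (CARD('n) - 1) s - 1) / s) (at s)" if s: "0 < s" "s < 1" for s
    proof -
      have "s\<^sup>2 < 1" using s by (simp add: abs_square_less_1)
      then have "chord (CARD('n) - 1) s = 1 - s\<^sup>2" by (simp add: chord_def n)
      then show ?thesis
        using s by (auto intro!: derivative_eq_intros simp: power2_eq_square)
    qed
    show "has_bochner_integral lborel (\<lambda>r. radial_kernel CARD('n) t r * r * indicator {0..2} r)
        ((ln (t\<^sup>2 + 2\<^sup>2) + t\<^sup>2 / (t\<^sup>2 + 2\<^sup>2) - 2 * ln t - 1) / 2)" if "0 < t" for t
      unfolding n by (rule near_field_integral_3[OF that])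
    show "((\<lambda>t. (ln (t\<^sup>2 + 2\<^sup>2) + t\<^sup>2 / (t\<^sup>2 + 2\<^sup>2) - 2 * ln t - 1) / 2 - ln (1 / t))
        \<longlongrightarrow> ln 2 - 1 / 2) (at_right (0::real))"
    proof -
      have ln4: "ln 2 = ln (4 :: real) / 2" using ln_realpow[of 2 2] by simp
      show ?thesis unfolding ln4 by (real_asymp simp: diff_divide_distrib)
    qed
  qed (use n in \<open>auto simp: radial_const_3 unit_ball_vol_2\<close>)
  then show ?thesis
    using area n assms(2) by (simp add: algebra_simps)
qed

end
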